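(* Let $ABC$ be a triangle with incenter $I$ and suppose $\angle ABC=120^\circ$. Let the cevians through $I$ be $AD$, $BE$, $CF$, with $D$ on side $BC$, $E$ on side $CA$, $F$ on side $AB$. Let $r_1$ be the radius of the excircle of $\triangle BID$ that touches side $BD$, $r_2$ the radius of the excircle of $\triangle CID$ that touches side $DC$, $r_3$ the radius of the excircle of $\triangle CIE$ that touches side $CE$, $r_4$ the radius of the excircle of $\triangle AIE$ that touches side $EA$, $r_5$ the radius of the excircle of $\triangle AIF$ that touches side $AF$, and $r_6$ the radius of the excircle of $\triangle BIF$ that touches side $FB$. Then $$\frac{1}{r_1}+\frac{1}{r_3}+\frac{1}{r_4}+\frac{1}{r_6}=\frac{1}{r_2}+\frac{1}{r_5}.$$
   Context: A cevian through a point $P$ inside a triangle is the segment from a vertex through $P$ to the opposite side. The excircle of a triangle that touches a given side is the circle tangent to that side (segment) and to the extensions of the other two sides, lying on the opposite side of that segment from the remaining vertex. *)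

theory Defs
  imports "HOL-Analysis.Analysis"
begin

type_synonym point = "real ^ 2"

definition angle :: "point \<Rightarrow> point \<Rightarrow> point \<Rightarrow> real" where
  "angle X Y Z = arccos (((X - Y) \<bullet> (Z - Y)) / (norm (X - Y) * norm (Z - Y)))"

definition is_triangle :: "point \<Rightarrow> point \<Rightarrow> point \<Rightarrow> bool" where
  "is_triangle A B C \<longleftrightarrow> \<not> collinear {A, B, C}"

text \<open>For \<open>Y \<noteq> Z\<close> and \<open>r > 0\<close>: the circle with centre \<open>J\<close> and radius \<open>r\<close> is tangent to the
  line \<open>YZ\<close> at \<open>T\<close>, i.e. \<open>T\<close> is their only common point.\<close>

definition tangent_line_at :: "point \<Rightarrow> real \<Rightarrow> point \<Rightarrow> point \<Rightarrow> point \<Rightarrow> bool" where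
  "tangent_line_at J r Y Z T \<longleftrightarrow> sphere J r \<inter> affine hull {Y, Z} = {T}"

definition touches_segment :: "point \<Rightarrow> real \<Rightarrow> point \<Rightarrow> point \<Rightarrow> bool" where
  "touches_segment J r Y Z \<longleftrightarrow> (\<exists>T \<in> closed_segment Y Z. tangent_line_at J r Y Z T)"

text \<open>Tangency to the extension of the segment \<open>XY\<close> beyond \<open>Y\<close>.\<close>

definition touches_extension :: "point \<Rightarrow> real \<Rightarrow> point \<Rightarrow> point \<Rightarrow> bool" where
  "touches_extension J r X Y \<longleftrightarrow> (\<exists>T. between (X, T) Y \<and> tangent_line_at J r X Y T)"

definition is_incircle :: "point \<Rightarrow> point \<Rightarrow> point \<Rightarrow> point \<Rightarrow> real \<Rightarrow> bool" where
  "is_incircle A B C J r \<longleftrightarrow>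
     r > 0 \<and> sphere J r \<subseteq> convex hull {A, B, C} \<and>
     touches_segment J r B C \<and> touches_segment J r C A \<and> touches_segment J r A B"

definition is_incenter :: "point \<Rightarrow> point \<Rightarrow> point \<Rightarrow> point \<Rightarrow> bool" where
  "is_incenter A B C J \<longleftrightarrow> (\<exists>r. is_incircle A B C J r)"

text \<open>\<open>is_cevian X Y Z P Q\<close>: the segment \<open>XQ\<close> is the cevian of the triangle \<open>XYZ\<close> from \<open>X\<close>
  through \<open>P\<close>, with foot \<open>Q\<close> on the side \<open>YZ\<close>.\<close>

definition is_cevian :: "point \<Rightarrow> point \<Rightarrow> point \<Rightarrow> point \<Rightarrow> point \<Rightarrow> bool" where
  "is_cevian X Y Z P Q \<longleftrightarrow> Q \<in> closed_segment Y Z \<and> P \<in> closed_segment X Q"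

text \<open>The excircle of the triangle \<open>XYZ\<close> that touches the side \<open>YZ\<close>. The last conjunct says that
  the whole circle lies in the closed half-plane of the line \<open>YZ\<close> not containing \<open>X\<close>.\<close>

definition is_excircle :: "point \<Rightarrow> point \<Rightarrow> point \<Rightarrow> point \<Rightarrow> real \<Rightarrow> bool" where
  "is_excircle X Y Z J r \<longleftrightarrow>
     r > 0 \<and> touches_segment J r Y Z \<and>
     touches_extension J r X Y \<and> touches_extension J r X Z \<and>
     (\<forall>Q \<in> sphere J r. closed_segment X Q \<inter> affine hull {Y, Z} \<noteq> {})"

definition is_exradius :: "point \<Rightarrow> point \<Rightarrow> point \<Rightarrow> real \<Rightarrow> bool" where
  "is_exradius X Y Z r \<longleftrightarrow> (\<exists>J. is_excircle X Y Z J r)"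

end

theory Submission
  imports Defs
begin

text \<open>
  Write \<open>a\<close>, \<open>b\<close>, \<open>c\<close> for the side lengths and \<open>S\<close> for twice the area. Since an exradius is
  \<open>2 [XYZ] / (XY + XZ - YZ)\<close>, the feet \<open>D\<close>, \<open>E\<close>, \<open>F\<close> of the bisectors turn every \<open>1/r\<^sub>i\<close> into
  \<open>(a + b + c) / S\<close> times an expression that is affine in \<open>IA\<close>, \<open>IB\<close>, \<open>IC\<close>. In the claimed
  identity the coefficients of \<open>IA\<close> and \<open>IC\<close> cancel for every triangle, and what remains is
  \<open>IB * (a + b + c) = a c\<close>, which is where the angle of 120 degrees enters.
\<close>

section \<open>Planar determinants and linear independence\<close>

text \<open>The 2x2 determinant. On two edge vectors from a common vertex its absolute value is
  twice the area of the triangle.\<close>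

definition wedge :: "point \<Rightarrow> point \<Rightarrow> real" where
  "wedge v w = v $ 1 * w $ 2 - v $ 2 * w $ 1"

lemma inner_point: "v \<bullet> w = v $ 1 * w $ 1 + v $ 2 * w $ 2" for v w :: point
  by (simp add: inner_vec_def sum_2)

text \<open>Lagrange's identity in the plane; it links areas with lengths and inner
  products.\<close>

lemma wedge_power2: "(wedge v w)\<^sup>2 = (norm v)\<^sup>2 * (norm w)\<^sup>2 - (v \<bullet> w)\<^sup>2"
  unfolding power2_norm_eq_inner inner_point wedge_def by algebra

text \<open>A vanishing determinant is the equality case of Cauchy-Schwarz, which forces
  collinearity.\<close>

lemma wedge_nonzero:
  assumes "\<not> collinear {A, B, C}"
  shows "wedge (B - A) (C - A) \<noteq> 0"
proof
  assume "wedge (B - A) (C - A) = 0"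
  then have "((B - A) \<bullet> (C - A))\<^sup>2 = (norm (B - A) * norm (C - A))\<^sup>2"
    using wedge_power2[of "B - A" "C - A"] by (simp add: power_mult_distrib)
  then have "\<bar>(B - A) \<bullet> (C - A)\<bar> = norm (B - A) * norm (C - A)"
    by (metis abs_mult abs_norm_cancel real_sqrt_abs)
  then have "collinear {0, B - A, C - A}"
    by (simp add: norm_cauchy_schwarz_equal)
  then have "collinear {B, A, C}"
    by (simp add: collinear_3)
  with assms show False
    by (simp add: insert_commute)
qed

lemma wedge_rotate: "wedge (C - B) (A - B) = wedge (B - A) (C - A)"
  by (simp add: wedge_def algebra_simps)

text \<open>Cramer's rule: the determinant times a coordinate of \<open>v\<close> is a linear
  combination of the two inner products.\<close>

lemma orthogonal_to_independent:
  assumes "wedge p q \<noteq> 0" "v \<bullet> p = 0" "v \<bullet> q = 0"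
  shows "v = 0"
proof -
  have "wedge p q * v $ 1 = 0" "wedge p q * v $ 2 = 0"
    using assms(2,3) unfolding wedge_def inner_point by algebra+
  with assms(1) show ?thesis
    by (simp add: vec_eq_iff forall_2)
qed

lemma independent_coeffs:
  assumes "wedge p q \<noteq> 0" "x *\<^sub>R p + y *\<^sub>R q = x' *\<^sub>R p + y' *\<^sub>R q"
  shows "x = x' \<and> y = y'"
proof -
  have coord: "x * p $ i + y * q $ i = x' * p $ i + y' * q $ i" for i
    using arg_cong[OF assms(2), of "\<lambda>v. v $ i"] by simp
  have "wedge p q * x = wedge p q * x'" "wedge p q * y = wedge p q * y'"
    unfolding wedge_def using coord[of 1] coord[of 2] by algebra+
  with assms(1) show ?thesis by simp
qed

section \<open>Tangent lines and tangent lengths\<close>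

lemma tangent_perp:
  assumes "sphere J r \<inter> affine hull S = {T}" "P \<in> affine hull S"
  shows "(J - T) \<bullet> (P - T) = 0"
proof (cases "P = T")
  case False
  \<comment> \<open>\<open>T + k *\<^sub>R (P - T)\<close> is the mirror image of \<open>T\<close>
    in the foot of the perpendicular from \<open>J\<close> to the line \<open>TP\<close>. It is
    again on the circle and in the hull, so uniqueness of \<open>T\<close> forces
    \<open>k = 0\<close>.\<close>
  define k where "k = 2 * ((J - T) \<bullet> (P - T)) / (norm (P - T))\<^sup>2"
  have T: "T \<in> affine hull S" "norm (J - T) = r"
    using insertI1[of T "{}"] unfolding assms(1)[symmetric] by (simp_all add: dist_norm)
  have "(1 - k) *\<^sub>R T + k *\<^sub>R P \<in> affine hull S"
    using T(1) assms(2) by (simp add: mem_affine)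
  then have hull: "T + k *\<^sub>R (P - T) \<in> affine hull S"
    by (simp add: algebra_simps)
  have "(norm (J - (T + k *\<^sub>R (P - T))))\<^sup>2
      = (norm (J - T))\<^sup>2 - 2 * k * ((J - T) \<bullet> (P - T)) + k\<^sup>2 * (norm (P - T))\<^sup>2"
    unfolding power2_norm_eq_inner by (simp add: inner_commute algebra_simps power2_eq_square)
  also have "k\<^sup>2 * (norm (P - T))\<^sup>2 = 2 * k * ((J - T) \<bullet> (P - T))"
    using False by (simp add: k_def power2_eq_square)
  finally have "(norm (J - (T + k *\<^sub>R (P - T))))\<^sup>2 = (norm (J - T))\<^sup>2"
    by simp
  then have "norm (J - (T + k *\<^sub>R (P - T))) = r"
    unfolding T(2)[symmetric] by (rule power2_eq_imp_eq) simp_all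
  with hull have "T + k *\<^sub>R (P - T) \<in> sphere J r \<inter> affine hull S"
    by (simp add: dist_norm)
  then have "T + k *\<^sub>R (P - T) = T"
    unfolding assms(1) by (rule singletonD)
  with False show ?thesis
    by (simp add: k_def)
qed simp

text \<open>The root of the power of the point \<open>P\<close>. It mentions no line, so the
  equality of the two tangents from a vertex is built in.\<close>

definition tangent_length :: "point \<Rightarrow> real \<Rightarrow> point \<Rightarrow> real" where
  "tangent_length J r P = sqrt ((norm (J - P))\<^sup>2 - r\<^sup>2)"

text \<open>Pythagoras in the right triangle \<open>JTP\<close>. The second equation records that
  the power is nonnegative here, so that squaring really undoes \<open>sqrt\<close>.\<close>

lemma tangent_line_at_length:
  assumes "tangent_line_at J r Y Z T" "P \<in> {Y, Z}"
  shows "dist P T = tangent_length J r P"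
    and "(tangent_length J r P)\<^sup>2 = (norm (J - P))\<^sup>2 - r\<^sup>2"
proof -
  have tan: "sphere J r \<inter> affine hull {Y, Z} = {T}"
    using assms(1) by (simp add: tangent_line_at_def)
  then have "(J - T) \<bullet> (P - T) = 0"
    using assms(2) by (intro tangent_perp) (auto intro: hull_inc)
  moreover have "norm (J - T) = r"
    using insertI1[of T "{}"] unfolding tan[symmetric] by (simp add: dist_norm)
  moreover have "(norm (J - P))\<^sup>2 = (norm (J - T))\<^sup>2 - 2 * ((J - T) \<bullet> (P - T)) + (norm (P - T))\<^sup>2"
    unfolding power2_norm_eq_inner by (simp add: inner_commute algebra_simps)
  ultimately have "(norm (J - P))\<^sup>2 - r\<^sup>2 = (dist P T)\<^sup>2"
    by (simp add: dist_norm)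
  then show "dist P T = tangent_length J r P"
    and "(tangent_length J r P)\<^sup>2 = (norm (J - P))\<^sup>2 - r\<^sup>2"
    by (simp_all add: tangent_length_def)
qed

lemma touches_segment_length:
  assumes "touches_segment J r Y Z"
  shows "norm (Z - Y) = tangent_length J r Y + tangent_length J r Z"
proof -
  obtain T where T: "T \<in> closed_segment Y Z" "tangent_line_at J r Y Z T"
    using assms by (auto simp: touches_segment_def)
  then have "dist Y Z = dist Y T + dist T Z"
    using between between_mem_segment by metis
  then show ?thesis
    using tangent_line_at_length(1)[OF T(2), of Y] tangent_line_at_length(1)[OF T(2), of Z]
    by (simp add: dist_norm norm_minus_commute)
qed

lemma touches_extension_length:
  assumes "touches_extension J r X Y"
  shows "norm (Y - X) = tangent_length J r X - tangent_length J r Y"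
proof -
  obtain T where T: "between (X, T) Y" "tangent_line_at J r X Y T"
    using assms by (auto simp: touches_extension_def)
  then have "dist X T = dist X Y + dist Y T"
    using between by metis
  then show ?thesis
    using tangent_line_at_length(1)[OF T(2), of X] tangent_line_at_length(1)[OF T(2), of Y]
    by (simp add: dist_norm norm_minus_commute)
qed

lemma inner_eq_norms: "(J - X) \<bullet> (Y - X) = ((norm (J - X))\<^sup>2 + (norm (Y - X))\<^sup>2 - (norm (J - Y))\<^sup>2) / 2"
  for J X Y :: "'a::real_inner"
  unfolding power2_norm_eq_inner by (simp add: inner_commute algebra_simps)

text \<open>Geometrically, the point of contact is the projection of \<open>J\<close> to the line.
  The proof uses lengths alone: by the law of cosines the radius cancels, and the side is the sum of
  its two tangent lengths.\<close>

lemma touches_segment_inner: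
  assumes "touches_segment J r Y Z"
  shows "(J - Y) \<bullet> (Z - Y) = tangent_length J r Y * norm (Z - Y)"
    and "(J - Z) \<bullet> (Y - Z) = tangent_length J r Z * norm (Y - Z)"
proof -
  obtain T where T: "tangent_line_at J r Y Z T"
    using assms by (auto simp: touches_segment_def)
  have sq: "(norm (J - Y))\<^sup>2 = (tangent_length J r Y)\<^sup>2 + r\<^sup>2"
    "(norm (J - Z))\<^sup>2 = (tangent_length J r Z)\<^sup>2 + r\<^sup>2"
    using tangent_line_at_length(2)[OF T] by auto
  show "(J - Y) \<bullet> (Z - Y) = tangent_length J r Y * norm (Z - Y)"
    unfolding inner_eq_norms sq touches_segment_length[OF assms]
    by (simp add: power2_eq_square algebra_simps)
  show "(J - Z) \<bullet> (Y - Z) = tangent_length J r Z * norm (Y - Z)"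
    unfolding inner_eq_norms sq norm_minus_commute[of Y Z] touches_segment_length[OF assms]
    by (simp add: power2_eq_square algebra_simps)
qed

lemma touches_extension_inner:
  assumes "touches_extension J r X Y"
  shows "(norm (J - X))\<^sup>2 = (tangent_length J r X)\<^sup>2 + r\<^sup>2"
    and "(J - X) \<bullet> (Y - X) = tangent_length J r X * norm (Y - X)"
proof -
  obtain T where T: "tangent_line_at J r X Y T"
    using assms by (auto simp: touches_extension_def)
  show sq: "(norm (J - X))\<^sup>2 = (tangent_length J r X)\<^sup>2 + r\<^sup>2"
    using tangent_line_at_length(2)[OF T] by auto
  have sq': "(norm (J - Y))\<^sup>2 = (tangent_length J r Y)\<^sup>2 + r\<^sup>2"
    using tangent_line_at_length(2)[OF T] by auto
  show "(J - X) \<bullet> (Y - X) = tangent_length J r X * norm (Y - X)"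
    unfolding inner_eq_norms sq sq' touches_extension_length[OF assms]
    by (simp add: power2_eq_square field_simps)
qed

section \<open>The exradius in terms of sides and area\<close>

text \<open>The tangent length \<open>s\<close> from \<open>X\<close> is the semiperimeter, which
  fixes the inner products of \<open>J - X\<close> with both edges at \<open>X\<close>. Together
  with the distance \<open>JX\<close> they overdetermine \<open>J\<close>, and the resulting
  relation yields \<open>r\<close>.\<close>

lemma exradius_formula:
  assumes "is_exradius X Y Z r" "wedge (Y - X) (Z - X) \<noteq> 0"
  shows "1 / r = (norm (Y - X) + norm (Z - X) - norm (Z - Y)) / \<bar>wedge (Y - X) (Z - X)\<bar>"
proof -
  obtain J where J: "r > 0" "touches_segment J r Y Z" "touches_extension J r X Y"
    "touches_extension J r X Z"
    using assms(1) by (auto simp: is_exradius_def is_excircle_def)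
  define s where "s = tangent_length J r X"
  define p q j P Q L \<Delta> where "p = Y - X" and "q = Z - X" and "j = J - X"
    and "P = norm p" and "Q = norm q" and "L = norm (Z - Y)" and "\<Delta> = \<bar>wedge p q\<bar>"
  have \<Delta>: "\<Delta> > 0"
    using assms(2) by (simp add: \<Delta>_def p_def q_def)
  have "2 * s = P + Q + L"
    using touches_segment_length[OF J(2)] touches_extension_length[OF J(3)]
      touches_extension_length[OF J(4)]
    by (simp add: s_def P_def Q_def L_def p_def q_def)
  have s: "s \<ge> 0"
    using \<open>2 * s = P + Q + L\<close> norm_ge_zero[of p] norm_ge_zero[of q] norm_ge_zero[of "Z - Y"]
    unfolding P_def Q_def L_def by linarith
  have jj: "(norm j)\<^sup>2 = s\<^sup>2 + r\<^sup>2" and jp: "j \<bullet> p = s * P" and jq: "j \<bullet> q = s * Q"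
    using touches_extension_inner[OF J(3)] touches_extension_inner[OF J(4)]
    by (simp_all add: s_def j_def p_def q_def P_def Q_def)
  have \<Delta>2: "\<Delta>\<^sup>2 = (P * Q - p \<bullet> q) * (P * Q + p \<bullet> q)"
    using wedge_power2[of p q] by (simp add: \<Delta>_def P_def Q_def power2_eq_square algebra_simps)
  \<comment> \<open>The Gram determinant of three vectors in the plane vanishes; here it is solved
    for \<open>j \<bullet> j\<close>.\<close>
  have "(wedge p q)\<^sup>2 * (j \<bullet> j)
      = (j \<bullet> p)\<^sup>2 * (q \<bullet> q) - 2 * (j \<bullet> p) * (j \<bullet> q) * (p \<bullet> q) + (j \<bullet> q)\<^sup>2 * (p \<bullet> p)"
    unfolding wedge_def inner_point by algebra
  then have "\<Delta>\<^sup>2 * (norm j)\<^sup>2 = (s * P)\<^sup>2 * Q\<^sup>2 - 2 * (s * P) * (s * Q) * (p \<bullet> q) + (s * Q)\<^sup>2 * P\<^sup>2"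
    by (simp add: \<Delta>_def jp jq flip: P_def Q_def power2_norm_eq_inner)
  then have "(\<Delta> * r)\<^sup>2 = (s * (P * Q - p \<bullet> q))\<^sup>2"
    using \<Delta>2 jj by algebra
  moreover have "P * Q - p \<bullet> q \<ge> 0"
    using norm_cauchy_schwarz[of p q] by (simp add: P_def Q_def)
  ultimately have \<Delta>r: "\<Delta> * r = s * (P * Q - p \<bullet> q)"
    using \<Delta> J(1) s by simp
  have "L\<^sup>2 = P\<^sup>2 + Q\<^sup>2 - 2 * (p \<bullet> q)"
    unfolding L_def P_def Q_def p_def q_def power2_norm_eq_inner
    by (simp add: inner_commute algebra_simps)
  \<comment> \<open>By the law of cosines twice the left side is (P + Q)^2 - L^2, whose factor P + Q
    + L is 2 s.\<close>
  then have "P * Q + p \<bullet> q = s * (P + Q - L)"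
    using \<open>2 * s = P + Q + L\<close> by algebra
  with \<Delta>2 \<Delta>r have "\<Delta> * (r * (P + Q - L)) = \<Delta> * \<Delta>"
    by algebra
  then have "r * (P + Q - L) = \<Delta>"
    using \<Delta> by simp
  then show ?thesis
    using \<Delta> J(1) by (simp add: field_simps \<Delta>_def P_def Q_def L_def p_def q_def)
qed

section \<open>The incenter, its cevians and the small triangles\<close>

text \<open>The incenter has barycentric weights a : b : c. Both sides have the same inner products
  with the independent edges at \<open>A\<close>, those of \<open>I - A\<close> being tangent length
  times side.\<close>

lemma incenter_barycentric:
  assumes "is_triangle A B C" "is_incenter A B C I"
  defines "a \<equiv> dist B C" and "b \<equiv> dist C A" and "c \<equiv> dist A B"
  shows "(a + b + c) *\<^sub>R (I - A) = b *\<^sub>R (B - A) + c *\<^sub>R (C - A)"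
proof -
  obtain r where r: "touches_segment I r B C" "touches_segment I r C A" "touches_segment I r A B"
    using assms(2) by (auto simp: is_incenter_def is_incircle_def)
  define m where "m = tangent_length I r A"
  define p q j where "p = B - A" and "q = C - A" and "j = I - A"
  have c: "c = norm p" and b: "b = norm q"
    by (simp_all add: b_def c_def p_def q_def dist_norm norm_minus_commute)
  have m: "2 * m = b + c - a"
    using r[THEN touches_segment_length]
    by (simp add: m_def a_def b_def c_def dist_norm norm_minus_commute)
  have jp: "j \<bullet> p = m * c" and jq: "j \<bullet> q = m * b"
    using touches_segment_inner(1)[OF r(3)] touches_segment_inner(2)[OF r(2)]
    by (simp_all add: m_def j_def p_def q_def b c)
  have "a\<^sup>2 = b\<^sup>2 + c\<^sup>2 - 2 * (p \<bullet> q)"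
    unfolding a_def b c p_def q_def power2_norm_eq_inner dist_norm
    by (simp add: inner_commute algebra_simps)
  then have pq: "p \<bullet> q = m * (a + b + c) - b * c"
    using m by algebra
  have "p \<bullet> p = c\<^sup>2" "q \<bullet> q = b\<^sup>2"
    by (simp_all add: b c power2_norm_eq_inner)
  then have "((a + b + c) *\<^sub>R j - (b *\<^sub>R p + c *\<^sub>R q)) \<bullet> p = 0"
    "((a + b + c) *\<^sub>R j - (b *\<^sub>R p + c *\<^sub>R q)) \<bullet> q = 0"
    by (simp_all add: jp jq pq inner_commute[of q p] power2_eq_square algebra_simps)
  moreover have "wedge p q \<noteq> 0"
    using wedge_nonzero assms(1) by (simp add: is_triangle_def p_def q_def)
  ultimately show ?thesis
    using orthogonal_to_independent by (fastforce simp: j_def p_def q_def)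
qed

text \<open>One cevian accounts for two of the six radii; cyclic renaming supplies the others. All
  side lengths and areas of the two small triangles are expressed by a, b, c, \<open>S\<close> and
  the distances from \<open>I\<close> to the vertices.\<close>

lemma cevian_exradii:
  assumes "is_triangle A B C" "is_incenter A B C I" "is_cevian A B C I D"
    and "is_exradius I B D r" "is_exradius I D C r'"
  defines "a \<equiv> dist B C" and "b \<equiv> dist C A" and "c \<equiv> dist A B"
    and "S \<equiv> \<bar>wedge (B - A) (C - A)\<bar>"
  shows "1 / r = (a + b + c) / S * (dist I B * (b + c) / (a * c) + dist I A / c - 1)"
    and "1 / r' = (a + b + c) / S * (dist I C * (b + c) / (a * b) + dist I A / b - 1)"
proof -
  have "A \<noteq> B" "B \<noteq> C" "C \<noteq> A"
    using assms(1) by (auto simp: is_triangle_def insert_commute)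
  then have pos: "a > 0" "b > 0" "c > 0"
    by (simp_all add: a_def b_def c_def)
  define n where "n = a + b + c"
  define p q where "p = B - A" and "q = C - A"
  have wpq: "wedge p q \<noteq> 0"
    using wedge_nonzero assms(1) by (simp add: is_triangle_def p_def q_def)
  have n: "n > 0"
    using pos by (simp add: n_def)
  obtain t u where t: "D = (1 - t) *\<^sub>R B + t *\<^sub>R C" and u: "I = (1 - u) *\<^sub>R A + u *\<^sub>R D"
    using assms(3) by (auto simp: is_cevian_def in_segment)
  have DA: "D - A = (1 - t) *\<^sub>R p + t *\<^sub>R q"
    unfolding t p_def q_def by (simp add: algebra_simps)
  have IA: "I - A = u *\<^sub>R (D - A)"
    unfolding u by (simp add: algebra_simps)
  \<comment> \<open>The incenter formula in the basis \<open>p\<close>, \<open>q\<close>. Comparing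
    coefficients shows that \<open>D\<close> divides \<open>BC\<close> as c : b and \<open>I\<close>
    divides \<open>AD\<close> as (b + c) : a.\<close>
  have "(n * u * (1 - t)) *\<^sub>R p + (n * u * t) *\<^sub>R q = b *\<^sub>R p + c *\<^sub>R q"
    using incenter_barycentric[OF assms(1,2)]
    by (simp add: IA DA n_def a_def b_def c_def p_def q_def scaleR_add_right mult.assoc)
  from independent_coeffs[OF wpq this]
  have ut: "n * u * (1 - t) = b" "n * u * t = c"
    by auto
  have "n * u = b + c"
    unfolding ut[symmetric] by (simp add: algebra_simps)
  then have u': "u = (b + c) / n" and t': "t = c / (b + c)" and t1': "1 - t = b / (b + c)"
    using ut n pos by (simp_all add: field_simps)
  have u1': "1 - u = a / n"
    using n by (simp add: u' n_def field_simps)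
  have ID: "D - I = (a / n) *\<^sub>R (D - A)"
    unfolding u1'[symmetric] using IA by (simp add: algebra_simps)
  have dIA: "dist I A = (b + c) / n * norm (D - A)" and "norm (D - I) = a / n * norm (D - A)"
    using IA ID u' pos n by (simp_all add: dist_norm)
  then have nID: "norm (D - I) = a / (b + c) * dist I A"
    using pos n by simp
  have "D - B = t *\<^sub>R (C - B)" "C - D = (1 - t) *\<^sub>R (C - B)"
    unfolding t by (simp_all add: algebra_simps)
  then have "D - B = (c / (b + c)) *\<^sub>R (C - B)" "C - D = (b / (b + c)) *\<^sub>R (C - B)"
    by (simp_all only: t1', simp only: t')
  then have BD: "norm (D - B) = c / (b + c) * a" and CD: "norm (C - D) = b / (b + c) * a"
    using pos by (simp_all add: a_def dist_norm norm_minus_commute)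
  have BI: "B - I = p - u *\<^sub>R (D - A)" and CI: "C - I = q - u *\<^sub>R (D - A)"
    by (simp_all add: p_def q_def flip: IA)
  \<comment> \<open>The area of \<open>BID\<close> is the fraction ID/AD times BD/BC of the
    whole.\<close>
  have "wedge (B - I) (D - I) = a / n * t * wedge p q"
    unfolding BI ID DA by (simp add: wedge_def algebra_simps add_divide_distrib diff_divide_distrib)
  then have w1: "\<bar>wedge (B - I) (D - I)\<bar> = a * c / (n * (b + c)) * S"
    using pos n by (simp add: S_def p_def q_def t' abs_mult)
  have "wedge (D - I) (C - I) = a / n * (1 - t) * wedge p q"
    unfolding CI ID DA by (simp add: wedge_def algebra_simps add_divide_distrib diff_divide_distrib)
  then have w2: "\<bar>wedge (D - I) (C - I)\<bar> = a * b / (n * (b + c)) * S"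
    using pos n by (simp add: S_def p_def q_def t1' abs_mult)
  have S: "S > 0"
    using wpq by (simp add: S_def p_def q_def)
  \<comment> \<open>The common shape of both computations: \<open>g\<close> is b + c,
    \<open>x\<close> is IA, and \<open>w\<close>, \<open>y\<close> are c, IB for the first radius
    and b, IC for the second.\<close>
  have quotient: "(y + a / g * x - w / g * a) / (a * w / (n * g) * S) = n / S * (y * g / (a * w) + x / w - 1)"
    if "g > 0" "w > 0" for g w x y :: real
    using that pos(1) n S by (simp add: field_simps)
  have "1 / r = (norm (B - I) + norm (D - I) - norm (D - B)) / \<bar>wedge (B - I) (D - I)\<bar>"
    using pos n S w1 by (intro exradius_formula[OF assms(4)]) auto
  also have "\<dots> = n / S * (dist I B * (b + c) / (a * c) + dist I A / c - 1)"
    unfolding w1 nID BD using quotient[of "b + c" c] pos by (simp add: dist_norm norm_minus_commute)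
  finally show "1 / r = (a + b + c) / S * (dist I B * (b + c) / (a * c) + dist I A / c - 1)"
    by (simp add: n_def)
  have "1 / r' = (norm (D - I) + norm (C - I) - norm (C - D)) / \<bar>wedge (D - I) (C - I)\<bar>"
    using pos n S w2 by (intro exradius_formula[OF assms(5)]) auto
  also have "\<dots> = n / S * (dist I C * (b + c) / (a * b) + dist I A / b - 1)"
    unfolding w2 nID CD using quotient[of "b + c" b] pos
    by (simp add: dist_norm norm_minus_commute add.commute)
  finally show "1 / r' = (a + b + c) / S * (dist I C * (b + c) / (a * b) + dist I A / b - 1)"
    by (simp add: n_def)
qed

section \<open>Cyclic renaming and the angle of 120 degrees\<close>

lemma is_triangle_rotate: "is_triangle A B C \<Longrightarrow> is_triangle B C A"
  by (simp add: is_triangle_def insert_commute)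

lemma is_incenter_rotate: "is_incenter A B C I \<Longrightarrow> is_incenter B C A I"
  by (auto simp: is_incenter_def is_incircle_def insert_commute)

lemma inner_of_angle:
  assumes "X \<noteq> Y" "Z \<noteq> Y"
  shows "(X - Y) \<bullet> (Z - Y) = cos (angle X Y Z) * (dist X Y * dist Z Y)"
proof -
  have "\<bar>((X - Y) \<bullet> (Z - Y)) / (norm (X - Y) * norm (Z - Y))\<bar> \<le> 1"
    using Cauchy_Schwarz_ineq2[of "X - Y" "Z - Y"] assms by (simp add: abs_mult divide_le_eq_1)
  then show ?thesis
    using assms by (simp add: angle_def cos_arccos_abs dist_norm)
qed

text \<open>The vector (a + b + c) (I - B) is the sum of c (C - B) and a (A - B). Both have length a
  c and enclose 120 degrees, so their sum has length a c as well.\<close>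

lemma dist_incenter_120:
  assumes "is_triangle A B C" "is_incenter A B C I" "angle A B C = 2 * pi / 3"
  shows "dist I B * (dist B C + dist C A + dist A B) = dist B C * dist A B"
proof -
  define a b c where "a = dist B C" and "b = dist C A" and "c = dist A B"
  define p q where "p = A - B" and "q = C - B"
  have ne: "A \<noteq> B" "C \<noteq> B"
    using assms(1) by (auto simp: is_triangle_def insert_commute)
  have nn: "a \<ge> 0" "b \<ge> 0" "c \<ge> 0"
    by (simp_all add: a_def b_def c_def)
  have pp: "p \<bullet> p = c\<^sup>2" "q \<bullet> q = a\<^sup>2"
    by (simp_all add: a_def c_def p_def q_def dist_norm norm_minus_commute
        flip: power2_norm_eq_inner)
  have pq: "p \<bullet> q = - (c * a) / 2"
    using inner_of_angle[OF ne] unfolding assms(3) cos_120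
    by (simp add: p_def q_def a_def c_def dist_commute)
  have "(a + b + c) *\<^sub>R (I - B) = c *\<^sub>R q + a *\<^sub>R p"
    using incenter_barycentric[OF assms(1)[THEN is_triangle_rotate] assms(2)[THEN is_incenter_rotate]]
    by (simp add: a_def b_def c_def p_def q_def algebra_simps)
  then have "((a + b + c) * dist I B)\<^sup>2 = (norm (c *\<^sub>R q + a *\<^sub>R p))\<^sup>2"
    using nn by (metis abs_of_nonneg add_nonneg_nonneg dist_norm norm_scaleR)
  also have "\<dots> = (a * c)\<^sup>2"
    unfolding power2_norm_eq_inner
    by (simp add: inner_commute[of q p] pp pq power2_eq_square algebra_simps)
  finally have "(a + b + c) * dist I B = a * c"
    using nn by simp
  then show ?thesis
    by (simp add: a_def b_def c_def mult.commute)
qed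

section \<open>Combining the six reciprocals\<close>

theorem theorem8p3:
  fixes A B C I D E F :: point and r1 r2 r3 r4 r5 r6 :: real
  assumes "is_triangle A B C"
    and "is_incenter A B C I"
    and "angle A B C = 2 * pi / 3"
    and "is_cevian A B C I D"
    and "is_cevian B C A I E"
    and "is_cevian C A B I F"
    and "is_exradius I B D r1"
    and "is_exradius I D C r2"
    and "is_exradius I C E r3"
    and "is_exradius I E A r4"
    and "is_exradius I A F r5"
    and "is_exradius I F B r6"
  shows "1 / r1 + 1 / r3 + 1 / r4 + 1 / r6 = 1 / r2 + 1 / r5"
proof -
  define a b c where "a = dist B C" and "b = dist C A" and "c = dist A B"
  define S where "S = \<bar>wedge (B - A) (C - A)\<bar>"
  define x y z where "x = dist I A" and "y = dist I B" and "z = dist I C"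
  define k where "k = (a + b + c) / S"
  have pos: "a > 0" "b > 0" "c > 0"
    using assms(1) by (auto simp: is_triangle_def insert_commute a_def b_def c_def)
  note tri2 = is_triangle_rotate[OF assms(1)] and inc2 = is_incenter_rotate[OF assms(2)]
  note tri3 = is_triangle_rotate[OF tri2] and inc3 = is_incenter_rotate[OF inc2]
  have S2: "wedge (C - B) (A - B) = wedge (B - A) (C - A)"
    and S3: "wedge (A - C) (B - C) = wedge (B - A) (C - A)"
    by (simp_all add: wedge_rotate)
  have r: "1 / r1 = k * (y * (b + c) / (a * c) + x / c - 1)"
    "1 / r2 = k * (z * (b + c) / (a * b) + x / b - 1)"
    "1 / r3 = k * (z * (c + a) / (b * a) + y / a - 1)"
    "1 / r4 = k * (x * (c + a) / (b * c) + y / c - 1)"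
    "1 / r5 = k * (x * (a + b) / (c * b) + z / b - 1)"
    "1 / r6 = k * (y * (a + b) / (c * a) + z / a - 1)"
    using cevian_exradii[OF assms(1,2,4,7,8)] cevian_exradii[OF tri2 inc2 assms(5,9,10)]
      cevian_exradii[OF tri3 inc3 assms(6,11,12)]
    unfolding S2 S3 k_def a_def b_def c_def x_def y_def z_def S_def
    by (simp_all only: ac_simps)
  \<comment> \<open>The \<open>- 1\<close> of each bracket is left out. Four of them stand on the
    left of the claim and two on the right, so the remaining terms must differ by exactly 2.\<close>
  have "y * (b + c) / (a * c) + x / c + (z * (c + a) / (b * a) + y / a)
      + (x * (c + a) / (b * c) + y / c) + (y * (a + b) / (c * a) + z / a)
      - (z * (b + c) / (a * b) + x / b) - (x * (a + b) / (c * b) + z / b)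
      = 2 * (y * (a + b + c)) / (a * c)"
    using pos by (simp add: field_simps)
  also have "y * (a + b + c) = a * c"
    using dist_incenter_120[OF assms(1-3)] by (simp add: y_def a_def b_def c_def)
  finally have "y * (b + c) / (a * c) + x / c + (z * (c + a) / (b * a) + y / a)
      + (x * (c + a) / (b * c) + y / c) + (y * (a + b) / (c * a) + z / a)
      - (z * (b + c) / (a * b) + x / b) - (x * (a + b) / (c * b) + z / b) = 2"
    using pos by simp
  \<comment> \<open>Stated for arbitrary \<open>u1\<close> to \<open>u6\<close>, so that the final
    bookkeeping does not touch the fractions.\<close>
  moreover have "k * (u1 - 1) + k * (u3 - 1) + k * (u4 - 1) + k * (u6 - 1) = k * (u2 - 1) + k * (u5 - 1)"
    if "u1 + u3 + u4 + u6 - u2 - u5 = 2" for u1 u2 u3 u4 u5 u6 :: real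
  proof -
    have "k * (u1 + u3 + u4 + u6 - u2 - u5) = k * 2"
      by (simp only: that)
    then show ?thesis
      by (simp add: algebra_simps)
  qed
  ultimately show ?thesis
    unfolding r by blast
qed

end
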